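(* Let $p_0=1+\frac{\log_6 2}{1+\log_6 2}$ and let $0<p<p_0$. Then there is no constant $C<\infty$ such that the inequality $$\|H_3(f_1,f_2,f_3)\|_{L^{p/3}(\mathbb{R})}\le C\,\|f_1\|_{L^p(\mathbb{R})}\|f_2\|_{L^p(\mathbb{R})}\|f_3\|_{L^p(\mathbb{R})}$$ holds for all piecewise continuous functions $f_1,f_2,f_3:\mathbb{R}\to\mathbb{R}$ with finite (bounded) support.
   Context: The trilinear Hilbert transform $H_3$ is defined, for piecewise continuous functions $f_1,f_2,f_3$ on $\mathbb{R}$ with finite (bounded) support, by $$H_3(f_1,f_2,f_3)(x)=\mathrm{p.v.}\int_{\mathbb{R}} f_1(x+t)\,f_2(x+2t)\,f_3(x+3t)\,\frac{dt}{t},$$ where p.v. denotes the principal value $\lim_{\varepsilon\to0^+}\int_{|t|>\varepsilon}$. For $0<q<\infty$, $\|f\|_{L^q(\mathbb{R})}=\left(\int_{\mathbb{R}}|f|^q\,dx\right)^{1/q}$ (only a quasi-norm when $q<1$). $\log_6$ is the logarithm in base $6$. *)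

theory Defs
  imports "HOL-Analysis.Analysis"
begin

text \<open>
  Finitely many discontinuities in every bounded interval, each with finite one-sided limits;
  the value at a discontinuity is arbitrary.
\<close>
definition piecewise_continuous :: "(real \<Rightarrow> real) \<Rightarrow> bool" where
  "piecewise_continuous f \<longleftrightarrow>
     (\<forall>a b. finite {x \<in> {a..b}. \<not> isCont f x}) \<and>
     (\<forall>x. (\<exists>l. (f \<longlongrightarrow> l) (at_left x)) \<and> (\<exists>r. (f \<longlongrightarrow> r) (at_right x)))"

definition bounded_support :: "(real \<Rightarrow> real) \<Rightarrow> bool" where
  "bounded_support f \<longleftrightarrow> bounded {x. f x \<noteq> 0}"

definition H3_trunc ::
  "real \<Rightarrow> (real \<Rightarrow> real) \<Rightarrow> (real \<Rightarrow> real) \<Rightarrow> (real \<Rightarrow> real) \<Rightarrow> real \<Rightarrow> real" where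
  "H3_trunc \<epsilon> f\<^sub>1 f\<^sub>2 f\<^sub>3 x =
     (LINT t:{t. \<bar>t\<bar> > \<epsilon>}|lborel. f\<^sub>1 (x + t) * f\<^sub>2 (x + 2 * t) * f\<^sub>3 (x + 3 * t) / t)"

definition H3_exists ::
  "(real \<Rightarrow> real) \<Rightarrow> (real \<Rightarrow> real) \<Rightarrow> (real \<Rightarrow> real) \<Rightarrow> real \<Rightarrow> bool" where
  "H3_exists f\<^sub>1 f\<^sub>2 f\<^sub>3 x \<longleftrightarrow>
     (\<exists>l. ((\<lambda>\<epsilon>. H3_trunc \<epsilon> f\<^sub>1 f\<^sub>2 f\<^sub>3 x) \<longlongrightarrow> l) (at_right 0))"

text \<open>
  The value is meaningful only at points where \<open>H3_exists\<close> holds. Such points need not be all of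
  the line: for step functions the truncated integrals typically diverge at the breakpoints.
\<close>
definition H3 ::
  "(real \<Rightarrow> real) \<Rightarrow> (real \<Rightarrow> real) \<Rightarrow> (real \<Rightarrow> real) \<Rightarrow> real \<Rightarrow> real" where
  "H3 f\<^sub>1 f\<^sub>2 f\<^sub>3 x = Lim (at_right 0) (\<lambda>\<epsilon>. H3_trunc \<epsilon> f\<^sub>1 f\<^sub>2 f\<^sub>3 x)"

text \<open>
  Extended-valued, so that a function outside \<open>L\<^sup>q\<close> has norm \<open>\<infinity>\<close> (and not \<open>0\<close>, as with the
  Bochner integral). The case distinction supplies \<open>\<infinity>\<close> raised to the power \<open>1/q\<close>.
\<close>
definition Lq_norm :: "real \<Rightarrow> (real \<Rightarrow> real) \<Rightarrow> ennreal" where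
  "Lq_norm q f =
     (let I = (\<integral>\<^sup>+ x. ennreal (\<bar>f x\<bar> powr q) \<partial>lborel)
      in if I = \<infinity> then \<infinity> else ennreal (enn2real I powr (1 / q)))"

end

theory Submission
  imports Defs
begin

text \<open>
  If \<open>a = x + t\<close>, \<open>b = x + 2 t\<close>, \<open>c = x + 3 t\<close>, then \<open>2 b = a + c\<close> and \<open>2 x = 3 a - c\<close>. Let \<open>a\<close> and
  \<open>c\<close> run through the numbers with \<open>n\<close> base-12 digits from \<open>{0, 1, 2, 3}\<close> and from \<open>{0, 1, 2}\<close>.
  There are \<open>4 ^ n\<close> and \<open>3 ^ n\<close> of them. Their sums \<open>a + c\<close> have digits in \<open>{0, \<dots>, 5}\<close>, so there
  are only \<open>6 ^ n\<close> sums, whereas \<open>3 a - c\<close> takes \<open>12 ^ n\<close> consecutive integer values, because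
  \<open>3 a\<^sub>0 - c\<^sub>0\<close> takes each of the twelve values \<open>-2, \<dots>, 9\<close> (lemma \<open>digit_sums_represent\<close>). Thus
  three small sets of \<open>a\<close>, \<open>b\<close>, \<open>c\<close> control a set of \<open>x\<close> that is as large as possible.

  Put \<open>N = 12 ^ n\<close>, replace \<open>c\<close> by \<open>c + 4 N\<close>, and let \<open>f\<^sub>1\<close>, \<open>f\<^sub>2\<close>, \<open>f\<^sub>3\<close> be the indicators of the
  unit neighbourhoods of the sets of \<open>a\<close>, \<open>b\<close>, \<open>c\<close>. The shift makes every \<open>t\<close> that contributes
  positive and of size comparable to \<open>N\<close>. Hence there is neither a singularity nor cancellation
  in the principal value, and \<open>H3\<close> is at least a constant times \<open>1 / N\<close> on an interval of length
  \<open>N / 2\<close> (lemma \<open>H3_witness\<close>). The inequality to be refuted would then give, up to constants,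
  \<open>N powr (3 / p - 1) \<le> C * (4 ^ n * 6 ^ n * 3 ^ n) powr (1 / p)\<close>, that is
  \<open>(12 powr (3 - p)) ^ n \<le> C' * 72 ^ n\<close> for all \<open>n\<close>. This forces \<open>12 powr p \<ge> 24\<close>, while
  \<open>p\<^sub>0\<close> is exactly \<open>ln 24 / ln 12\<close>.
\<close>

section \<open>Numbers with restricted base-12 digits\<close>

fun digit_sums :: "nat \<Rightarrow> nat \<Rightarrow> real set" where
  "digit_sums k 0 = {0}"
| "digit_sums k (Suc n) = (\<lambda>(m, d). 12 * m + real d) ` (digit_sums k n \<times> {..k})"

lemma digit_sums_SucI:
  "m \<in> digit_sums k n \<Longrightarrow> d \<le> k \<Longrightarrow> 12 * m + real d \<in> digit_sums k (Suc n)"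
  by force

lemma finite_digit_sums: "finite (digit_sums k n)"
  by (induction n) auto

lemma card_digit_sums: "card (digit_sums k n) \<le> Suc k ^ n"
proof (induction n)
  case (Suc n)
  have "card (digit_sums k (Suc n)) \<le> card (digit_sums k n \<times> {..k})"
    unfolding digit_sums.simps by (rule card_image_le) (simp add: finite_digit_sums)
  also have "\<dots> \<le> Suc k ^ n * Suc k"
    unfolding card_cartesian_product card_atMost by (rule mult_right_mono[OF Suc]) simp
  finally show ?case by (simp add: mult.commute)
qed simp

lemma digit_sums_bounds:
  assumes "k \<le> 11" "m \<in> digit_sums k n"
  shows "0 \<le> m \<and> m \<le> 12 ^ n - 1"
  using assms(2)
proof (induction n arbitrary: m)
  case (Suc n)
  then obtain m' d where "m' \<in> digit_sums k n" "d \<le> k" "m = 12 * m' + real d"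
    by auto
  with Suc.IH[of m'] assms(1) show ?case by simp
qed simp

text \<open>
  The number with all \<open>n\<close> digits equal to \<open>2\<close>: subtracting it moves the digit range
  \<open>{0, \<dots>, 11}\<close> to the range \<open>{-2, \<dots>, 9}\<close> of \<open>3 a\<^sub>0 - c\<^sub>0\<close>.
\<close>
fun twos :: "nat \<Rightarrow> real" where
  "twos 0 = 0"
| "twos (Suc n) = 12 * twos n + 2"

text \<open>
  The combinatorial core, proved digit by digit: a digit \<open>e < 12\<close> satisfies
  \<open>e - 2 = 3 a\<^sub>0 - c\<^sub>0\<close> with \<open>a\<^sub>0 = e div 3\<close> and \<open>c\<^sub>0 = 2 - e mod 3\<close>. No carries occur in
  \<open>a + c\<close>, as \<open>3 + 2 < 12\<close>.
\<close>
lemma digit_sums_represent: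
  assumes "j < 12 ^ n"
  obtains a c where "a \<in> digit_sums 3 n" "c \<in> digit_sums 2 n" "a + c \<in> digit_sums 5 n"
    "3 * a - c = real j - twos n"
proof -
  have "\<exists>a\<in>digit_sums 3 n. \<exists>c\<in>digit_sums 2 n. a + c \<in> digit_sums 5 n \<and>
          3 * a - c = real j - twos n"
    using assms
  proof (induction n arbitrary: j)
    case (Suc n)
    define e where "e = j mod 12"
    define a0 where "a0 = e div 3"
    define c0 where "c0 = 2 - e mod 3"
    have j: "j = 12 * (j div 12) + e" unfolding e_def by simp
    have "e < 12" unfolding e_def by simp
    then have le: "a0 \<le> 3" "c0 \<le> 2" "a0 + c0 \<le> 5"
      unfolding a0_def c0_def by linarith+
    have "3 * a0 + 2 = e + c0"
      unfolding a0_def c0_def using mult_div_mod_eq[of 3 e] mod_less_divisor[of 3 e] by linarith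
    then have digit: "3 * real a0 + 2 = real e + real c0" by linarith
    have "j div 12 < 12 ^ n" using Suc.prems by auto
    with Suc.IH obtain a c where ac: "a \<in> digit_sums 3 n" "c \<in> digit_sums 2 n"
      "a + c \<in> digit_sums 5 n" "3 * a - c = real (j div 12) - twos n" by blast
    have "real j = 12 * real (j div 12) + real e"
      by (subst j) simp
    then have "3 * (12 * a + real a0) - (12 * c + real c0) = real j - twos (Suc n)"
      using ac(4) digit by simp
    moreover have "(12 * a + real a0) + (12 * c + real c0) \<in> digit_sums 5 (Suc n)"
      using digit_sums_SucI[OF ac(3) le(3)] by (simp add: algebra_simps)
    ultimately show ?case
      using digit_sums_SucI[OF ac(1) le(1)] digit_sums_SucI[OF ac(2) le(2)] by blast
  qed simp
  then show thesis using that by blast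
qed

section \<open>Indicators of unit neighbourhoods of finite sets\<close>

definition unit_nhd :: "real set \<Rightarrow> real set" where
  "unit_nhd S = (\<Union>s\<in>S. {s - 1..s + 1})"

lemma unit_nhdI: "s \<in> S \<Longrightarrow> \<bar>y - s\<bar> \<le> 1 \<Longrightarrow> y \<in> unit_nhd S"
  unfolding unit_nhd_def by (force simp: abs_le_iff)

lemma unit_nhd_bounds:
  assumes "y \<in> unit_nhd S" "\<And>s. s \<in> S \<Longrightarrow> l \<le> s \<and> s \<le> u"
  shows "l - 1 \<le> y" "y \<le> u + 1"
  using assms unfolding unit_nhd_def by fastforce+

lemma borel_unit_nhd [measurable]: "finite S \<Longrightarrow> unit_nhd S \<in> sets borel"
  unfolding unit_nhd_def by (intro sets.finite_UN) auto

lemma emeasure_unit_nhd: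
  assumes "finite S"
  shows "emeasure lborel (unit_nhd S) \<le> ennreal (2 * real (card S))"
proof -
  have "emeasure lborel (unit_nhd S) \<le> (\<Sum>s\<in>S. emeasure lborel {s - 1..s + 1})"
    unfolding unit_nhd_def by (intro emeasure_subadditive_finite assms) auto
  also have "\<dots> = (\<Sum>s\<in>S. ennreal 2)"
    by (intro sum.cong) auto
  also have "\<dots> = ennreal (2 * real (card S))"
    by (simp add: ennreal_mult ennreal_of_nat_eq_real_of_nat mult.commute)
  finally show ?thesis .
qed

lemma bounded_support_unit_nhd:
  assumes "finite S"
  shows "bounded_support (indicator (unit_nhd S))"
proof -
  have "{x. indicator (unit_nhd S) x \<noteq> (0::real)} = unit_nhd S"
    by (auto simp: indicator_def)
  then show ?thesis
    unfolding bounded_support_def unit_nhd_def using assms by (simp add: bounded_UN)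
qed

lemma piecewise_continuous_interval: "piecewise_continuous (indicator {l..r})"
  unfolding piecewise_continuous_def
proof (intro conjI allI)
  fix a b :: real
  have "{x \<in> {a..b}. \<not> isCont (indicator {l..r} :: real \<Rightarrow> real) x} \<subseteq> {l, r}"
    by (auto simp: isCont_indicator frontier_def)
  then show "finite {x \<in> {a..b}. \<not> isCont (indicator {l..r} :: real \<Rightarrow> real) x}"
    using finite_subset by blast
next
  fix x :: real
  have "\<exists>v::real. eventually (\<lambda>y. indicator {l..r} y = v) (at_left x)"
  proof -
    consider "x \<le> l" | "l < x" "x \<le> r" | "r < x" by linarith
    then show ?thesis
    proof cases
      case 1
      then show ?thesis
        by (intro exI[of _ 0]) (auto simp: eventually_at_left_field intro!: exI[of _ "x - 1"])
    next
      case 2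
      then show ?thesis
        by (intro exI[of _ 1]) (auto simp: eventually_at_left_field intro!: exI[of _ l])
    next
      case 3
      then show ?thesis
        by (intro exI[of _ 0]) (auto simp: eventually_at_left_field intro!: exI[of _ r])
    qed
  qed
  then show "\<exists>v. ((indicator {l..r} :: real \<Rightarrow> real) \<longlongrightarrow> v) (at_left x)"
    using tendsto_eventually by blast
  have "\<exists>v::real. eventually (\<lambda>y. indicator {l..r} y = v) (at_right x)"
  proof -
    consider "r \<le> x" | "l \<le> x" "x < r" | "x < l" by linarith
    then show ?thesis
    proof cases
      case 1
      then show ?thesis
        by (intro exI[of _ 0]) (auto simp: eventually_at_right_field intro!: exI[of _ "x + 1"])
    next
      case 2
      then show ?thesis
        by (intro exI[of _ 1]) (auto simp: eventually_at_right_field intro!: exI[of _ r])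
    next
      case 3
      then show ?thesis
        by (intro exI[of _ 0]) (auto simp: eventually_at_right_field intro!: exI[of _ l])
    qed
  qed
  then show "\<exists>v. ((indicator {l..r} :: real \<Rightarrow> real) \<longlongrightarrow> v) (at_right x)"
    using tendsto_eventually by blast
qed

text \<open>Inclusion-exclusion turns a union into a polynomial in the two indicators.\<close>
lemma piecewise_continuous_indicator_Un:
  assumes "piecewise_continuous (indicator A)" "piecewise_continuous (indicator B)"
  shows "piecewise_continuous (indicator (A \<union> B))"
proof -
  let ?f = "indicator A :: real \<Rightarrow> real" and ?g = "indicator B :: real \<Rightarrow> real"
  have eq: "indicator (A \<union> B) = (\<lambda>x. ?f x + ?g x - ?f x * ?g x)"
    by (auto simp: indicator_def fun_eq_iff)
  show ?thesis
    unfolding piecewise_continuous_def eq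
  proof (intro conjI allI)
    fix a b :: real
    have "{x \<in> {a..b}. \<not> isCont (\<lambda>x. ?f x + ?g x - ?f x * ?g x) x}
        \<subseteq> {x \<in> {a..b}. \<not> isCont ?f x} \<union> {x \<in> {a..b}. \<not> isCont ?g x}"
      by (auto intro!: continuous_intros)
    moreover have "finite \<dots>"
      using assms unfolding piecewise_continuous_def by blast
    ultimately show "finite {x \<in> {a..b}. \<not> isCont (\<lambda>x. ?f x + ?g x - ?f x * ?g x) x}"
      by (rule finite_subset)
  next
    fix x :: real
    have limit: "\<exists>l. ((\<lambda>x. ?f x + ?g x - ?f x * ?g x) \<longlongrightarrow> l) F"
      if "\<exists>l. (?f \<longlongrightarrow> l) F" "\<exists>l. (?g \<longlongrightarrow> l) F" for F
    proof -
      from that obtain l m where "(?f \<longlongrightarrow> l) F" "(?g \<longlongrightarrow> m) F" by blast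
      then have "((\<lambda>x. ?f x + ?g x - ?f x * ?g x) \<longlongrightarrow> l + m - l * m) F"
        by (intro tendsto_intros)
      then show ?thesis by blast
    qed
    show "\<exists>l. ((\<lambda>x. ?f x + ?g x - ?f x * ?g x) \<longlongrightarrow> l) (at_left x)"
      "\<exists>l. ((\<lambda>x. ?f x + ?g x - ?f x * ?g x) \<longlongrightarrow> l) (at_right x)"
      using assms unfolding piecewise_continuous_def by (auto intro!: limit)
  qed
qed

lemma piecewise_continuous_unit_nhd:
  assumes "finite S"
  shows "piecewise_continuous (indicator (unit_nhd S))"
  using assms
proof (induction S)
  case empty
  have eq: "unit_nhd {} = {1..0}" by (simp add: unit_nhd_def)
  show ?case unfolding eq by (rule piecewise_continuous_interval)
next
  case (insert s S)
  have "unit_nhd (insert s S) = {s - 1..s + 1} \<union> unit_nhd S"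
    by (simp add: unit_nhd_def)
  then show ?case
    using insert.IH piecewise_continuous_interval piecewise_continuous_indicator_Un by simp
qed

section \<open>Elementary bounds for the quasi-norms\<close>

lemma Lq_norm_indicator_le:
  assumes "0 < q" "0 \<le> K" "E \<in> sets lborel" "emeasure lborel E \<le> ennreal K"
  shows "Lq_norm q (indicator E) \<le> ennreal (K powr (1 / q))"
proof -
  have "(\<integral>\<^sup>+ x. ennreal (\<bar>indicator E x :: real\<bar> powr q) \<partial>lborel) = (\<integral>\<^sup>+ x. indicator E x \<partial>lborel)"
    by (intro nn_integral_cong) (auto simp: indicator_def)
  also have "\<dots> = emeasure lborel E" using assms(3) by simp
  finally have I: "(\<integral>\<^sup>+ x. ennreal (\<bar>indicator E x :: real\<bar> powr q) \<partial>lborel) = emeasure lborel E" .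
  moreover have "enn2real (emeasure lborel E) \<le> K"
    using assms(2,4) enn2real_leI by blast
  moreover have "emeasure lborel E \<noteq> \<infinity>"
    using assms(4) by (auto simp: top_unique)
  ultimately show ?thesis
    unfolding Lq_norm_def Let_def I using assms(1) by (auto intro!: ennreal_leI powr_mono2)
qed

lemma Lq_norm_ge_on_interval:
  assumes "0 < q" "0 \<le> v" "u \<le> w" "\<And>x. x \<in> {u..<w} \<Longrightarrow> v \<le> \<bar>f x\<bar>"
  shows "ennreal ((v powr q * (w - u)) powr (1 / q)) \<le> Lq_norm q f"
proof -
  define I where "I = (\<integral>\<^sup>+ x. ennreal (\<bar>f x\<bar> powr q) \<partial>lborel)"
  have "ennreal (v powr q * (w - u)) = (\<integral>\<^sup>+ x. ennreal (v powr q) * indicator {u..<w} x \<partial>lborel)"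
    using assms(3) by (simp add: nn_integral_cmult_indicator ennreal_mult)
  also have "\<dots> \<le> I"
    unfolding I_def using assms
    by (intro nn_integral_mono) (auto simp: indicator_def intro!: powr_mono2)
  finally have le: "ennreal (v powr q * (w - u)) \<le> I" .
  show ?thesis
  proof (cases "I = \<infinity>")
    case True
    then show ?thesis unfolding Lq_norm_def Let_def I_def[symmetric] by simp
  next
    case False
    then have "v powr q * (w - u) \<le> enn2real I"
      using le by (cases I) (auto simp: top_unique ennreal_le_iff)
    then show ?thesis
      unfolding Lq_norm_def Let_def I_def[symmetric] using False assms
      by (auto intro!: ennreal_leI powr_mono2)
  qed
qed

section \<open>Lower bound for the trilinear Hilbert transform\<close>

text \<open>
  When the product of the three indicators is supported in \<open>t \<in> {\<alpha>..\<beta>}\<close> with \<open>\<alpha> > 0\<close>, all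
  truncations at level below \<open>\<alpha>\<close> coincide with an ordinary integral of a nonnegative function.
\<close>
lemma H3_indicators:
  fixes E\<^sub>1 E\<^sub>2 E\<^sub>3 :: "real set" and x \<alpha> \<beta> :: real
  assumes meas [measurable]: "E\<^sub>1 \<in> sets borel" "E\<^sub>2 \<in> sets borel" "E\<^sub>3 \<in> sets borel"
    and "0 < \<alpha>"
    and supp: "\<And>t. x + t \<in> E\<^sub>1 \<Longrightarrow> x + 2 * t \<in> E\<^sub>2 \<Longrightarrow> x + 3 * t \<in> E\<^sub>3 \<Longrightarrow> \<alpha> \<le> t \<and> t \<le> \<beta>"
  shows "H3_exists (indicator E\<^sub>1) (indicator E\<^sub>2) (indicator E\<^sub>3) x"
    and "\<lbrakk>l \<le> r; \<And>t. t \<in> {l..r} \<Longrightarrow> x + t \<in> E\<^sub>1 \<and> x + 2 * t \<in> E\<^sub>2 \<and> x + 3 * t \<in> E\<^sub>3\<rbrakk>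
      \<Longrightarrow> (r - l) / \<beta> \<le> H3 (indicator E\<^sub>1) (indicator E\<^sub>2) (indicator E\<^sub>3) x"
proof -
  define T where "T = {t. x + t \<in> E\<^sub>1 \<and> x + 2 * t \<in> E\<^sub>2 \<and> x + 3 * t \<in> E\<^sub>3}"
  define g :: "real \<Rightarrow> real" where "g t = indicator T t / t" for t
  let ?H = "\<lambda>\<epsilon>. H3_trunc \<epsilon> (indicator E\<^sub>1) (indicator E\<^sub>2) (indicator E\<^sub>3) x"
  have T: "T \<subseteq> {\<alpha>..\<beta>}" using supp unfolding T_def by auto
  have [measurable]: "T \<in> sets borel" unfolding T_def by measurable
  have g_meas: "g \<in> borel_measurable lborel" unfolding g_def by measurable
  have int: "integrable lborel g"
  proof (rule Bochner_Integration.integrable_bound)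
    show "integrable lborel (\<lambda>t. indicator {\<alpha>..\<beta>} t / \<alpha> :: real)"
      by (intro integrable_divide) (simp add: integrable_indicator_iff emeasure_lborel_Icc_eq)
    show "AE t in lborel. norm (g t) \<le> norm (indicator {\<alpha>..\<beta>} t / \<alpha> :: real)"
      using T \<open>0 < \<alpha>\<close> unfolding g_def
      by (intro AE_I2) (auto simp: indicator_def intro!: divide_left_mono)
  qed (rule g_meas)
  have trunc: "?H \<epsilon> = integral\<^sup>L lborel g" if "\<epsilon> < \<alpha>" for \<epsilon>
    unfolding H3_trunc_def set_lebesgue_integral_def
    using T that \<open>0 < \<alpha>\<close> unfolding g_def T_def
    by (intro Bochner_Integration.integral_cong) (auto simp: indicator_def)
  have "eventually (\<lambda>\<epsilon>. ?H \<epsilon> = integral\<^sup>L lborel g) (at_right 0)"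
    using \<open>0 < \<alpha>\<close> trunc by (auto simp: eventually_at_right_field)
  then have lim: "(?H \<longlongrightarrow> integral\<^sup>L lborel g) (at_right 0)"
    by (rule tendsto_eventually)
  then show "H3_exists (indicator E\<^sub>1) (indicator E\<^sub>2) (indicator E\<^sub>3) x"
    unfolding H3_exists_def by blast
  have H3: "H3 (indicator E\<^sub>1) (indicator E\<^sub>2) (indicator E\<^sub>3) x = integral\<^sup>L lborel g"
    unfolding H3_def by (rule tendsto_Lim[OF _ lim]) simp
  show "(r - l) / \<beta> \<le> H3 (indicator E\<^sub>1) (indicator E\<^sub>2) (indicator E\<^sub>3) x"
    if "l \<le> r" and lr: "\<And>t. t \<in> {l..r} \<Longrightarrow> x + t \<in> E\<^sub>1 \<and> x + 2 * t \<in> E\<^sub>2 \<and> x + 3 * t \<in> E\<^sub>3"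
  proof -
    have lrT: "{l..r} \<subseteq> T" using lr unfolding T_def by auto
    have "(r - l) / \<beta> = (LINT t|lborel. indicator {l..r} t / \<beta>)"
      using \<open>l \<le> r\<close> by simp
    also have "\<dots> \<le> integral\<^sup>L lborel g"
    proof (rule integral_mono)
      show "integrable lborel (\<lambda>t. indicator {l..r} t / \<beta> :: real)"
        by (intro integrable_divide) (simp add: integrable_indicator_iff emeasure_lborel_Icc_eq)
      show "indicator {l..r} t / \<beta> \<le> g t" for t
        using T lrT \<open>0 < \<alpha>\<close> unfolding g_def
        by (auto simp: indicator_def subset_iff intro!: divide_left_mono)
    qed (rule int)
    finally show ?thesis unfolding H3 .
  qed
qed

text \<open>
  The unit neighbourhoods of \<open>a\<close>, \<open>(a + c + 4 N) / 2\<close>, \<open>c + 4 N\<close> from the introduction. A point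
  \<open>x\<close> of the interval is within \<open>1 / 2\<close> of a point \<open>x0 = (3 a - c - 4 N) / 2\<close>; with
  \<open>t0 = (c + 4 N - a) / 2\<close>, all \<open>t\<close> within \<open>1 / 6\<close> of \<open>t0\<close> contribute, because
  \<open>1 / 2 + 3 / 6 = 1\<close>.
\<close>
lemma H3_witness:
  fixes n :: nat
  defines "N \<equiv> 12 ^ n :: real"
  defines "E\<^sub>1 \<equiv> unit_nhd (digit_sums 3 n)"
    and "E\<^sub>2 \<equiv> unit_nhd ((\<lambda>s. (s + 4 * N) / 2) ` digit_sums 5 n)"
    and "E\<^sub>3 \<equiv> unit_nhd ((\<lambda>c. c + 4 * N) ` digit_sums 2 n)"
  defines "u \<equiv> (- twos n - 4 * N) / 2"
  shows "H3_exists (indicator E\<^sub>1) (indicator E\<^sub>2) (indicator E\<^sub>3) x"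
    and "x \<in> {u..<u + N / 2} \<Longrightarrow>
      1 / (11 * N) \<le> H3 (indicator E\<^sub>1) (indicator E\<^sub>2) (indicator E\<^sub>3) x"
proof -
  have N: "1 \<le> N" unfolding N_def by simp
  have meas: "E\<^sub>1 \<in> sets borel" "E\<^sub>2 \<in> sets borel" "E\<^sub>3 \<in> sets borel"
    unfolding E\<^sub>1_def E\<^sub>2_def E\<^sub>3_def by (auto intro!: borel_unit_nhd finite_digit_sums)
  have supp: "N / 2 \<le> t \<and> t \<le> 7 * N / 2" if "x + t \<in> E\<^sub>1" "x + 2 * t \<in> E\<^sub>2" "x + 3 * t \<in> E\<^sub>3" for t
  proof -
    have "0 \<le> s \<and> s \<le> N - 1" if "s \<in> digit_sums 3 n" for s
      using digit_sums_bounds[of 3 s n] that unfolding N_def by simp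
    note unit_nhd_bounds[OF \<open>x + t \<in> E\<^sub>1\<close>[unfolded E\<^sub>1_def] this]
    moreover have "4 * N \<le> s \<and> s \<le> 5 * N - 1" if "s \<in> (\<lambda>c. c + 4 * N) ` digit_sums 2 n" for s
      using digit_sums_bounds[of 2 "s - 4 * N" n] that unfolding N_def by auto
    note unit_nhd_bounds[OF \<open>x + 3 * t \<in> E\<^sub>3\<close>[unfolded E\<^sub>3_def] this]
    ultimately show ?thesis using N by linarith
  qed
  have "0 < N / 2" using N by simp
  note bound = H3_indicators[where x = x, OF meas this supp]
  show "H3_exists (indicator E\<^sub>1) (indicator E\<^sub>2) (indicator E\<^sub>3) x"
    by (rule bound(1))
  assume x: "x \<in> {u..<u + N / 2}"
  define j where "j = nat \<lfloor>2 * x + twos n + 4 * N\<rfloor>"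
  have "0 \<le> 2 * x + twos n + 4 * N" "2 * x + twos n + 4 * N < N"
    using x unfolding u_def atLeastLessThan_iff by argo+
  then have j: "real j \<le> 2 * x + twos n + 4 * N" "2 * x + twos n + 4 * N < real j + 1"
    and "real j < N"
    unfolding j_def by linarith+
  then have "j < 12 ^ n"
    unfolding N_def by (metis of_nat_less_iff of_nat_numeral of_nat_power)
  then obtain a c where ac: "a \<in> digit_sums 3 n" "c \<in> digit_sums 2 n" "a + c \<in> digit_sums 5 n"
    and eq: "3 * a - c = real j - twos n"
    by (rule digit_sums_represent)
  define t0 where "t0 = (c + 4 * N - a) / 2"
  have "x + t \<in> E\<^sub>1 \<and> x + 2 * t \<in> E\<^sub>2 \<and> x + 3 * t \<in> E\<^sub>3" if "t \<in> {t0 - 1 / 6..t0 + 1 / 6}" for t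
  proof -
    have t: "t0 - 1 / 6 \<le> t" "t \<le> t0 + 1 / 6" using that by auto
    have "\<bar>x + t - a\<bar> \<le> 1" "\<bar>x + 2 * t - (a + c + 4 * N) / 2\<bar> \<le> 1"
      "\<bar>x + 3 * t - (c + 4 * N)\<bar> \<le> 1"
      using t j eq unfolding t0_def abs_le_iff by argo+
    with ac show ?thesis
      unfolding E\<^sub>1_def E\<^sub>2_def E\<^sub>3_def by (blast intro: unit_nhdI)
  qed
  with bound(2)[of "t0 - 1 / 6" "t0 + 1 / 6"]
  have "(1 / 3) / (7 * N / 2) \<le> H3 (indicator E\<^sub>1) (indicator E\<^sub>2) (indicator E\<^sub>3) x"
    by simp
  moreover have "1 / (11 * N) \<le> (1 / 3) / (7 * N / 2)" using N by (simp add: field_simps)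
  ultimately show "1 / (11 * N) \<le> H3 (indicator E\<^sub>1) (indicator E\<^sub>2) (indicator E\<^sub>3) x"
    by linarith
qed

section \<open>Unboundedness below the critical exponent\<close>

lemma critical_exponent: "1 + log 6 2 / (1 + log 6 2) = ln 24 / ln (12::real)"
proof -
  have "ln (12::real) = ln 6 + ln 2" "ln (24::real) = ln 12 + ln 2"
    using ln_mult[of 6 "2::real"] ln_mult[of 12 "2::real"] by simp_all
  moreover have "0 < ln (6::real)" "ln 6 + ln (2::real) \<noteq> 0"
    using ln_gt_zero[of "2::real"] ln_gt_zero[of "6::real"] by linarith+
  ultimately show ?thesis unfolding log_def by (simp add: field_simps del: ln_mult)
qed

text \<open>
  The inequality tested on the functions of \<open>H3_witness\<close>, raised to the power \<open>p\<close>; the factor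
  \<open>72 = 4 * 6 * 3\<close> comes from the numbers of digits allowed for \<open>a\<close>, \<open>a + c\<close>, \<open>c\<close>.
\<close>
lemma growth_bound:
  fixes p C :: real and n :: nat
  assumes "0 < p" "0 \<le> C"
    and bound: "\<And>f\<^sub>1 f\<^sub>2 f\<^sub>3. piecewise_continuous f\<^sub>1 \<Longrightarrow> piecewise_continuous f\<^sub>2 \<Longrightarrow>
      piecewise_continuous f\<^sub>3 \<Longrightarrow> bounded_support f\<^sub>1 \<Longrightarrow> bounded_support f\<^sub>2 \<Longrightarrow>
      bounded_support f\<^sub>3 \<Longrightarrow> (AE x in lborel. H3_exists f\<^sub>1 f\<^sub>2 f\<^sub>3 x) \<Longrightarrow>
      Lq_norm (p / 3) (H3 f\<^sub>1 f\<^sub>2 f\<^sub>3)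
        \<le> ennreal C * Lq_norm p f\<^sub>1 * Lq_norm p f\<^sub>2 * Lq_norm p f\<^sub>3"
  shows "(12 powr (3 - p) / 72) ^ n \<le> 64 * 11 powr p * C powr p"
proof -
  define N :: real where "N = 12 ^ n"
  define S\<^sub>1 where "S\<^sub>1 = digit_sums 3 n"
  define S\<^sub>2 where "S\<^sub>2 = (\<lambda>s. (s + 4 * N) / 2) ` digit_sums 5 n"
  define S\<^sub>3 where "S\<^sub>3 = (\<lambda>c. c + 4 * N) ` digit_sums 2 n"
  define u where "u = (- twos n - 4 * N) / 2"
  let ?f = "\<lambda>S. indicator (unit_nhd S) :: real \<Rightarrow> real"
  have N: "1 \<le> N" unfolding N_def by simp
  have fin: "finite S\<^sub>1" "finite S\<^sub>2" "finite S\<^sub>3"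
    unfolding S\<^sub>1_def S\<^sub>2_def S\<^sub>3_def by (simp_all add: finite_digit_sums)
  have card: "card S\<^sub>1 \<le> 4 ^ n" "card S\<^sub>2 \<le> 6 ^ n" "card S\<^sub>3 \<le> 3 ^ n"
    using card_digit_sums[of 3 n] card_digit_sums[of 5 n] card_digit_sums[of 2 n]
    unfolding S\<^sub>1_def S\<^sub>2_def S\<^sub>3_def
    by (auto intro: order_trans[OF card_image_le[OF finite_digit_sums]])
  have norm: "Lq_norm p (?f S) \<le> ennreal ((2 * real k ^ n) powr (1 / p))"
    if "finite S" "card S \<le> k ^ n" for S and k :: nat
  proof (rule Lq_norm_indicator_le)
    have "real (card S) \<le> real k ^ n" using that(2) by (metis of_nat_le_iff of_nat_power)
    then show "emeasure lborel (unit_nhd S) \<le> ennreal (2 * real k ^ n)"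
      by (intro order_trans[OF emeasure_unit_nhd[OF that(1)]] ennreal_leI) simp
  qed (use assms that in auto)
  have "ennreal (((1 / (11 * N)) powr (p / 3) * (u + N / 2 - u)) powr (1 / (p / 3)))
      \<le> Lq_norm (p / 3) (H3 (?f S\<^sub>1) (?f S\<^sub>2) (?f S\<^sub>3))"
  proof (rule Lq_norm_ge_on_interval)
    fix x assume "x \<in> {u..<u + N / 2}"
    then show "1 / (11 * N) \<le> \<bar>H3 (?f S\<^sub>1) (?f S\<^sub>2) (?f S\<^sub>3) x\<bar>"
      using H3_witness(2)[of x n] unfolding S\<^sub>1_def S\<^sub>2_def S\<^sub>3_def N_def u_def by linarith
  qed (use assms N in auto)
  also have "\<dots> \<le> ennreal C * Lq_norm p (?f S\<^sub>1) * Lq_norm p (?f S\<^sub>2) * Lq_norm p (?f S\<^sub>3)"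
    using fin H3_witness(1)[of n] unfolding S\<^sub>1_def S\<^sub>2_def S\<^sub>3_def N_def
    by (intro bound piecewise_continuous_unit_nhd bounded_support_unit_nhd AE_I2) auto
  also have "\<dots> \<le> ennreal C * ennreal ((2 * 4 ^ n) powr (1 / p)) *
      ennreal ((2 * 6 ^ n) powr (1 / p)) * ennreal ((2 * 3 ^ n) powr (1 / p))"
    using norm[OF fin(1), of 4] norm[OF fin(2), of 6] norm[OF fin(3), of 3] card
    by (intro mult_mono) auto
  also have "\<dots> = ennreal (C * (2 * 4 ^ n) powr (1 / p) * (2 * 6 ^ n) powr (1 / p) *
      (2 * 3 ^ n) powr (1 / p))"
    using \<open>0 \<le> C\<close> by (simp add: ennreal_mult)
  also have "\<dots> = ennreal (C * (8 * 72 ^ n) powr (1 / p))"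
    by (simp add: powr_mult[symmetric] power_mult_distrib[symmetric] mult.assoc
        flip: power_mult_distrib)
  finally have "((1 / (11 * N)) powr (p / 3) * (N / 2)) powr (3 / p)
      \<le> C * (8 * 72 ^ n) powr (1 / p)"
    using \<open>0 \<le> C\<close> by (simp add: ennreal_le_iff)
  then have "(((1 / (11 * N)) powr (p / 3) * (N / 2)) powr (3 / p)) powr p
      \<le> (C * (8 * 72 ^ n) powr (1 / p)) powr p"
    using \<open>0 < p\<close> by (intro powr_mono2) auto
  moreover have "(((1 / (11 * N)) powr (p / 3) * (N / 2)) powr (3 / p)) powr p
      = (1 / (11 * N)) powr p * (N / 2) powr 3"
  proof -
    have "(((1 / (11 * N)) powr (p / 3) * (N / 2)) powr (3 / p)) powr p
        = ((1 / (11 * N)) powr (p / 3) * (N / 2)) powr 3"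
      using \<open>0 < p\<close> by (simp only: powr_powr) simp
    also have "\<dots> = ((1 / (11 * N)) powr (p / 3)) powr 3 * (N / 2) powr 3"
      by (rule powr_mult)
    also have "((1 / (11 * N)) powr (p / 3)) powr 3 = (1 / (11 * N)) powr p"
      by (simp add: powr_powr del: powr_numeral)
    finally show ?thesis .
  qed
  moreover have "(C * (8 * 72 ^ n) powr (1 / p)) powr p = C powr p * (8 * 72 ^ n)"
    using \<open>0 < p\<close> \<open>0 \<le> C\<close> by (simp add: powr_powr powr_mult)
  ultimately have "(1 / (11 * N)) powr p * (N / 2) powr 3 \<le> C powr p * (8 * 72 ^ n)"
    by metis
  moreover have "(1 / (11 * N)) powr p = 1 / (11 powr p * N powr p)"
    using N by (simp add: powr_divide powr_mult)
  moreover have "(N / 2) powr 3 = N powr 3 / 8" using N by (simp add: powr_divide)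
  ultimately have "1 / (11 powr p * N powr p) * (N powr 3 / 8) \<le> C powr p * (8 * 72 ^ n)"
    by metis
  then have "N powr 3 / N powr p \<le> 64 * 11 powr p * C powr p * 72 ^ n"
    using N by (simp add: field_simps)
  then have "N powr (3 - p) \<le> 64 * 11 powr p * C powr p * 72 ^ n"
    by (simp add: powr_diff)
  moreover have "N powr (3 - p) = (12 powr (3 - p)) ^ n"
    unfolding N_def by (simp add: powr_realpow[symmetric] powr_powr mult.commute)
  ultimately show ?thesis
    by (simp add: power_divide divide_le_eq)
qed

theorem theorem2p5:
  fixes p p\<^sub>0 :: real
  assumes "p\<^sub>0 = 1 + log 6 2 / (1 + log 6 2)"
    and "0 < p" and "p < p\<^sub>0"
  shows "\<not> (\<exists>C::real. \<forall>f\<^sub>1 f\<^sub>2 f\<^sub>3 :: real \<Rightarrow> real.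
           piecewise_continuous f\<^sub>1 \<and> piecewise_continuous f\<^sub>2 \<and> piecewise_continuous f\<^sub>3 \<and>
           bounded_support f\<^sub>1 \<and> bounded_support f\<^sub>2 \<and> bounded_support f\<^sub>3 \<and>
           (AE x in lborel. H3_exists f\<^sub>1 f\<^sub>2 f\<^sub>3 x) \<longrightarrow>
           Lq_norm (p / 3) (H3 f\<^sub>1 f\<^sub>2 f\<^sub>3)
             \<le> ennreal C * Lq_norm p f\<^sub>1 * Lq_norm p f\<^sub>2 * Lq_norm p f\<^sub>3)"
proof
  assume "\<exists>C::real. \<forall>f\<^sub>1 f\<^sub>2 f\<^sub>3 :: real \<Rightarrow> real.
           piecewise_continuous f\<^sub>1 \<and> piecewise_continuous f\<^sub>2 \<and> piecewise_continuous f\<^sub>3 \<and>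
           bounded_support f\<^sub>1 \<and> bounded_support f\<^sub>2 \<and> bounded_support f\<^sub>3 \<and>
           (AE x in lborel. H3_exists f\<^sub>1 f\<^sub>2 f\<^sub>3 x) \<longrightarrow>
           Lq_norm (p / 3) (H3 f\<^sub>1 f\<^sub>2 f\<^sub>3)
             \<le> ennreal C * Lq_norm p f\<^sub>1 * Lq_norm p f\<^sub>2 * Lq_norm p f\<^sub>3"
  then obtain C :: real where C: "\<And>f\<^sub>1 f\<^sub>2 f\<^sub>3. piecewise_continuous f\<^sub>1 \<Longrightarrow>
      piecewise_continuous f\<^sub>2 \<Longrightarrow> piecewise_continuous f\<^sub>3 \<Longrightarrow> bounded_support f\<^sub>1 \<Longrightarrow>
      bounded_support f\<^sub>2 \<Longrightarrow> bounded_support f\<^sub>3 \<Longrightarrow> (AE x in lborel. H3_exists f\<^sub>1 f\<^sub>2 f\<^sub>3 x) \<Longrightarrow>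
      Lq_norm (p / 3) (H3 f\<^sub>1 f\<^sub>2 f\<^sub>3) \<le> ennreal C * Lq_norm p f\<^sub>1 * Lq_norm p f\<^sub>2 * Lq_norm p f\<^sub>3"
    by blast
  \<comment> \<open>A negative constant acts as \<open>0\<close> in \<^typ>\<open>ennreal\<close>.\<close>
  have "ennreal C = ennreal (max 0 C)" by (simp add: max_def ennreal_neg)
  with C have growth: "(12 powr (3 - p) / 72) ^ n \<le> 64 * 11 powr p * max 0 C powr p" for n
    by (intro growth_bound[OF \<open>0 < p\<close>]) auto
  have "p * ln 12 < ln (24::real)"
    using assms critical_exponent by (simp add: pos_less_divide_eq)
  then have "12 powr p < exp (ln (24::real))"
    unfolding powr_def by (simp del: exp_ln exp_ln_iff)
  also have "exp (ln (24::real)) = 24" by simp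
  finally have "12 powr p < (24::real)" .
  then have "1 < 12 powr (3 - p) / (72::real)"
    by (simp add: powr_diff field_simps)
  then obtain n where "64 * 11 powr p * max 0 C powr p < (12 powr (3 - p) / 72) ^ n"
    using real_arch_pow by blast
  with growth[of n] show False by simp
qed

end
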